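(* For every integer $n \geq 1$, the number of $\underline{32}1$-avoiding permutations of $[n+1]$ with maximum inversion number (among all $\underline{32}1$-avoiding permutations of $[n+1]$) is $$|\mathcal{Z}_{n+1}(\underline{32}1)| = \binom{\rho_n}{\lambda_n}+\binom{\rho_n+1}{\lambda_n-1},$$ where $$\rho_n = \left\lfloor \frac{-3 + \sqrt{8n+17}}{2} \right\rfloor \qquad\text{and}\qquad \lambda_n = n + 2 - T_{\rho_n+1},$$ and $T_i = \binom{i+1}{2} = \sum_{j=1}^i j$ is the $i$th triangular number. These permutations have inversion number $$\operatorname{maxinv} \mathcal{S}_{n+1}(\underline{32}1)=T_{n-\rho_n} + \sum_{i=1}^{\rho_n} T_i = \binom{n-\rho_n +1}{2} + \binom{\rho_n + 2}{3}.$$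
   Context: $\mathcal{S}_N$ is the set of permutations $\pi=\pi_1\pi_2\cdots\pi_N$ of $[N]=\{1,\dots,N\}$. A permutation $\pi \in \mathcal{S}_N$ is $\underline{32}1$-avoiding when there do not exist $1 \leq i < i+1 < j \leq N$ with $\pi_i > \pi_{i+1} > \pi_j$; the set of such permutations is $\mathcal{S}_N(\underline{32}1)$. The inversion number is $\operatorname{inv}(\pi) = |\{(i,j) : i<j \text{ and } \pi_i>\pi_j\}|$. $\operatorname{maxinv}\mathcal{S}_N(\underline{32}1)$ is the maximum of $\operatorname{inv}(\pi)$ over $\pi \in \mathcal{S}_N(\underline{32}1)$, and $\mathcal{Z}_N(\underline{32}1)$ is the set of $\pi\in\mathcal{S}_N(\underline{32}1)$ achieving this maximum. Convention: $\binom{a}{b}=0$ if $b<0$ or $b>a$ (for integers $a\ge 0$). *)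

theory Defs
  imports Complex_Main "HOL-Combinatorics.Permutations"
begin

(* The permutation p = p_1 p_2 ... p_N is the function p with p i = p_i; the positions of the
   underlined letters 3, 2 are adjacent, the position of the letter 1 is arbitrary further right. *)
definition avoids_u32_1 :: "nat \<Rightarrow> (nat \<Rightarrow> nat) \<Rightarrow> bool" where
  "avoids_u32_1 N p \<longleftrightarrow>
     \<not> (\<exists>i j. 1 \<le> i \<and> i + 1 < j \<and> j \<le> N \<and> p i > p (i + 1) \<and> p (i + 1) > p j)"

definition S_u32_1 :: "nat \<Rightarrow> (nat \<Rightarrow> nat) set" where
  "S_u32_1 N = {p. p permutes {1..N} \<and> avoids_u32_1 N p}"

definition inv_num :: "nat \<Rightarrow> (nat \<Rightarrow> nat) \<Rightarrow> nat" where
  "inv_num N p = card {(i, j). i \<in> {1..N} \<and> j \<in> {1..N} \<and> i < j \<and> p i > p j}"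

definition maxinv_u32_1 :: "nat \<Rightarrow> nat" where
  "maxinv_u32_1 N = Max (inv_num N ` S_u32_1 N)"

definition Z_u32_1 :: "nat \<Rightarrow> (nat \<Rightarrow> nat) set" where
  "Z_u32_1 N = {p \<in> S_u32_1 N. inv_num N p = maxinv_u32_1 N}"

(* Binomial coefficients with integer entries, since a lower entry can be -1 below. *)
definition ibinom :: "int \<Rightarrow> int \<Rightarrow> nat" where
  "ibinom a b = (if 0 \<le> b \<and> b \<le> a then nat a choose nat b else 0)"

definition tri :: "int \<Rightarrow> nat" where
  "tri i = ibinom (i + 1) 2"

definition rho :: "nat \<Rightarrow> int" where
  "rho n = \<lfloor>(- 3 + sqrt (8 * real n + 17)) / 2\<rfloor>"

definition lambda :: "nat \<Rightarrow> int" where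
  "lambda n = int n + 2 - int (tri (rho n + 1))"

(* tri i is the triangular number for i >= 0 (and 0 for i < 0); since 1 <= rho n <= n, the indices
   n - rho n, rho n + 1 and 1, ..., rho n that occur are all nonnegative. *)

lemma tri_eq_sum: "tri (int k) = (\<Sum>j=1..k. j)"
proof -
  have "tri (int k) = (k + 1) choose 2"
    by (cases k) (auto simp: tri_def ibinom_def nat_add_distrib)
  also have "\<dots> = (\<Sum>j=1..k. j)"
    by (induction k) (auto simp: numeral_2_eq_2)
  finally show ?thesis .
qed

lemma rho_bounds:
  assumes "n \<ge> 1"
  shows "1 \<le> rho n" "rho n \<le> int n"
proof -
  have "5 \<le> sqrt (8 * real n + 17)"
    using assms by (intro real_le_rsqrt) auto
  then show "1 \<le> rho n"
    unfolding rho_def by (simp add: le_floor_iff)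
  have "sqrt (8 * real n + 17) \<le> 2 * real n + 3"
  proof (rule real_le_lsqrt)
    have "1 * 1 \<le> real n * real n"
      using assms by (intro mult_mono) auto
    then show "8 * real n + 17 \<le> (2 * real n + 3)\<^sup>2"
      using assms unfolding power2_eq_square by (simp only: algebra_simps)
  qed auto
  then show "rho n \<le> int n"
    unfolding rho_def by (simp add: floor_le_iff)
qed

end

theory Submission
  imports Defs "HOL-Library.Nat_Bijection" "HOL-Combinatorics.Multiset_Permutations"
begin

text \<open>
  A word \<open>as m bs\<close> with least letter \<open>m\<close> is avoiding iff \<open>as\<close> is increasing and \<open>bs\<close> is avoiding. If
  it has length \<open>N\<close> and \<open>as\<close> has length \<open>k\<close>, it has at most \<open>k (N - k) + inv bs\<close> inversions, with
  equality iff \<open>as\<close> consists of the \<open>k\<close> largest letters. So the maximum \<open>M N\<close> satisfies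
  \<open>M N = max\<^sub>k (k (N - k) + M (N - 1 - k))\<close>, and the maximal words are counted by iterating the
  optimal choices of \<open>k\<close>. The solution is \<open>M N = T\<^sub>N - max\<^sub>r (\<Sum>i=1..r. N + 1 - T\<^sub>i)\<close>. If the inner maximum is
  attained at \<open>R\<close>, then comparing with the term \<open>R - 1\<close> of the maximum for \<open>N - 1 - k\<close> gives
  \<open>M N - k (N - k) - M (N - 1 - k) \<ge> (k - R) (k - R + 1) / 2 \<ge> 0\<close>. Hence \<open>k\<close> is \<open>R - 1\<close> or \<open>R\<close>, and with
  \<open>R = \<rho> + 1\<close> the two choices lead from \<open>(\<rho>, \<lambda>)\<close> to \<open>(\<rho> - 1, \<lambda>)\<close> and \<open>(\<rho> - 1, \<lambda> - 1)\<close>, which is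
  Pascal's rule for the claimed count.
\<close>

section \<open>Pattern avoidance and inversions of words\<close>

fun avoiding :: "'a::linorder list \<Rightarrow> bool" where
  "avoiding (x # y # zs) \<longleftrightarrow> (y < x \<longrightarrow> (\<forall>z\<in>set zs. y \<le> z)) \<and> avoiding (y # zs)"
| "avoiding _ \<longleftrightarrow> True"

primrec inversions :: "'a::linorder list \<Rightarrow> nat" where
  "inversions [] = 0"
| "inversions (x # xs) = length (filter (\<lambda>y. y < x) xs) + inversions xs"

lemma inversions_append:
  "inversions (xs @ ys) = inversions xs + inversions ys + (\<Sum>x\<leftarrow>xs. length (filter (\<lambda>y. y < x) ys))"
  by (induction xs) auto

lemma inversions_sorted: "sorted xs \<Longrightarrow> inversions xs = 0"
  by (induction xs) (auto simp: filter_empty_conv not_less)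

text \<open>A descent within \<open>as\<close> is followed by the smaller letter \<open>m\<close>
  and completes the pattern. The descent into \<open>m\<close> is harmless, as nothing smaller
  follows, and \<open>m\<close> starts no descent.\<close>

lemma avoiding_append_Cons_least:
  assumes "\<And>x. x \<in> set as \<union> set bs \<Longrightarrow> m < x"
  shows "avoiding (as @ m # bs) \<longleftrightarrow> sorted as \<and> avoiding bs"
  using assms
proof (induction as)
  case Nil
  then show ?case by (cases bs) (auto dest: order.asym)
next
  case (Cons a as)
  have IH: "avoiding (as @ m # bs) \<longleftrightarrow> sorted as \<and> avoiding bs"
    using Cons by auto
  show ?case
  proof (cases as)
    case Nil
    then show ?thesis using IH Cons.prems by force
  next
    case (Cons a' as')
    have "m < a'" using Cons Cons.prems by auto
    then show ?thesis using IH Cons by (auto simp: not_less sorted2 simp del: sorted_wrt.simps)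
  qed
qed

lemma inversions_append_Cons_least:
  assumes "\<And>x. x \<in> set as \<union> set bs \<Longrightarrow> m < x" and "sorted as"
  shows "inversions (as @ m # bs) =
    length as + (\<Sum>a\<leftarrow>as. length (filter (\<lambda>b. b < a) bs)) + inversions bs"
proof -
  have "filter (\<lambda>y. y < m) bs = []"
    using assms(1) by (fastforce simp: filter_empty_conv)
  moreover have "(\<Sum>x\<leftarrow>as. length (filter (\<lambda>y. y < x) (m # bs))) =
      length as + (\<Sum>a\<leftarrow>as. length (filter (\<lambda>b. b < a) bs))"
    using assms(1) by (induction as) auto
  ultimately show ?thesis
    using assms(2) by (simp add: inversions_append inversions_sorted)
qed

lemma cross_inversions_le:
  "(\<Sum>a\<leftarrow>as. length (filter (\<lambda>b. b < a) bs)) \<le> length as * length bs"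
  by (induction as) (auto intro: add_mono)

text \<open>Each letter of \<open>as\<close> contributes at most \<open>length bs\<close>, so
  equality for the sum forces equality for every letter.\<close>

lemma cross_inversions_eq_iff:
  fixes as bs :: "'a::linorder list"
  shows "(\<Sum>a\<leftarrow>as. length (filter (\<lambda>b. b < a) bs)) = length as * length bs \<longleftrightarrow>
    (\<forall>a\<in>set as. \<forall>b\<in>set bs. b < a)"
proof (induction as)
  case (Cons a as)
  have "length (filter (\<lambda>b. b < a) bs) \<le> length bs" by simp
  moreover have "length (filter (\<lambda>b. b < a) bs) = length bs \<longleftrightarrow> (\<forall>b\<in>set bs. b < a)"
    using length_filter_less[of _ bs "\<lambda>b. b < a"] by (metis filter_True less_irrefl)
  moreover have "u + v = c + d \<longleftrightarrow> u = c \<and> v = d" if "u \<le> c" "v \<le> d" for u v c d :: nat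
    using that by linarith
  ultimately show ?case
    using Cons.IH cross_inversions_le[of bs as] by simp
qed simp

section \<open>Permutations as words\<close>

lemma inversions_map_upt:
  "inversions (map p [a..<b]) = card {(i, j). a \<le> i \<and> i < j \<and> j < b \<and> p j < p i}"
proof (induction "b - a" arbitrary: a)
  case 0
  then have "{(i, j). a \<le> i \<and> i < j \<and> j < b \<and> p j < p i} = {}" by auto
  then show ?case using 0 by (simp only: card.empty) simp
next
  case (Suc d)
  then have "a < b" by simp
  let ?X = "Pair a ` {j \<in> {Suc a..<b}. p j < p a}"
  let ?Y = "{(i, j). Suc a \<le> i \<and> i < j \<and> j < b \<and> p j < p i}"
  have "{(i, j). a \<le> i \<and> i < j \<and> j < b \<and> p j < p i} = ?X \<union> ?Y"
    by (auto simp: image_iff Suc_le_eq le_less)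
  moreover have "finite ?Y"
    by (rule finite_subset[of _ "{..<b} \<times> {..<b}"]) auto
  then have "card (?X \<union> ?Y) = card ?X + card ?Y"
    by (intro card_Un_disjoint) auto
  ultimately have "card {(i, j). a \<le> i \<and> i < j \<and> j < b \<and> p j < p i} = card ?X + card ?Y"
    by simp
  also have "card ?X = card {j \<in> {Suc a..<b}. p j < p a}"
    by (rule card_image) (simp add: inj_on_def)
  also have "\<dots> = length (filter (\<lambda>y. y < p a) (map p [Suc a..<b]))"
    using distinct_card[of "filter (\<lambda>j. p j < p a) [Suc a..<b]"]
    by (simp add: filter_map comp_def)
  finally show ?case
    using Suc \<open>a < b\<close> by (simp add: upt_conv_Cons)
qed

lemma avoiding_map_upt:
  "avoiding (map p [a..<b]) \<longleftrightarrow>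
    \<not> (\<exists>i j. a \<le> i \<and> i + 1 < j \<and> j < b \<and> p i > p (i + 1) \<and> p (i + 1) > p j)"
proof (induction "b - a" arbitrary: a)
  case (Suc d)
  then have IH: "avoiding (map p [Suc a..<b]) \<longleftrightarrow>
    \<not> (\<exists>i j. Suc a \<le> i \<and> i + 1 < j \<and> j < b \<and> p i > p (i + 1) \<and> p (i + 1) > p j)"
    by simp
  have split: "(\<exists>i j. a \<le> i \<and> Q i j) \<longleftrightarrow> (\<exists>j. Q a j) \<or> (\<exists>i j. Suc a \<le> i \<and> Q i j)"
    for Q :: "nat \<Rightarrow> nat \<Rightarrow> bool"
    by (metis Suc_le_eq le_less)
  show ?case
  proof (cases "Suc a < b")
    case True
    then have "avoiding (map p [a..<b]) \<longleftrightarrow>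
        (p (Suc a) < p a \<longrightarrow> (\<forall>j\<in>{Suc (Suc a)..<b}. \<not> p j < p (Suc a))) \<and> avoiding (map p [Suc a..<b])"
      by (simp add: upt_conv_Cons not_less)
    also have "(p (Suc a) < p a \<longrightarrow> (\<forall>j\<in>{Suc (Suc a)..<b}. \<not> p j < p (Suc a))) \<longleftrightarrow>
        \<not> (\<exists>j. a + 1 < j \<and> j < b \<and> p a > p (a + 1) \<and> p (a + 1) > p j)"
      by (auto simp: Suc_le_eq)
    finally show ?thesis
      unfolding IH split[of "\<lambda>i j. i + 1 < j \<and> j < b \<and> p i > p (i + 1) \<and> p (i + 1) > p j"]
      by blast
  next
    case False
    then have "b = Suc a" using Suc by simp
    then show ?thesis by auto
  qed
qed auto

text \<open>A permutation is the identity outside \<open>{1..N}\<close>, so its word determines it;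
  surjectivity follows from equal cardinalities.\<close>

lemma bij_betw_map_permutes:
  "bij_betw (\<lambda>p. map p [1..<Suc N]) {p. p permutes {1..N}} (permutations_of_set {1..N})"
proof -
  let ?f = "\<lambda>p::nat \<Rightarrow> nat. map p [1..<Suc N]"
  have inj: "inj_on ?f {p. p permutes {1..N}}"
  proof (rule inj_onI)
    fix p q assume "p \<in> {p. p permutes {1..N}}" "q \<in> {p. p permutes {1..N}}" "?f p = ?f q"
    then show "p = q"
      by (intro ext) (metis (mono_tags) atLeastLessThanSuc_atLeastAtMost map_eq_conv mem_Collect_eq
        permutes_not_in set_upt)
  qed
  have "?f ` {p. p permutes {1..N}} = permutations_of_set {1..N}"
  proof (rule card_subset_eq)
    show "?f ` {p. p permutes {1..N}} \<subseteq> permutations_of_set {1..N}"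
      by (auto simp del: upt_Suc simp: permutations_of_set_def distinct_map permutes_inj_on
        permutes_image atLeastLessThanSuc_atLeastAtMost)
    show "card (?f ` {p. p permutes {1..N}}) = card (permutations_of_set {1..N})"
      unfolding card_image[OF inj] by (simp add: card_permutations)
  qed simp
  with inj show ?thesis by (simp add: bij_betw_def)
qed

section \<open>Triangular numbers and the candidate maximum\<close>

lemma triangle_mono: "m \<le> n \<Longrightarrow> triangle m \<le> triangle n"
  by (rule lift_Suc_mono_le) auto

lemma double_triangle: "2 * int (triangle n) = int n * (int n + 1)"
  by (induction n) (auto simp: algebra_simps)

definition level :: "nat \<Rightarrow> nat" where
  "level N = (GREATEST r. triangle r \<le> Suc N)"

lemma le_triangle: "n \<le> triangle n"
  by (induction n) auto

lemma level_bounds: "triangle (level N) \<le> Suc N" "Suc N < triangle (Suc (level N))"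
proof -
  have bound: "r \<le> Suc N" if "triangle r \<le> Suc N" for r
    using le_triangle[of r] that by linarith
  show "triangle (level N) \<le> Suc N"
    unfolding level_def by (rule GreatestI_nat[of _ 0 "Suc N"]) (use bound in auto)
  show "Suc N < triangle (Suc (level N))"
  proof (rule ccontr)
    assume "\<not> ?thesis"
    then have "Suc (level N) \<le> level N"
      unfolding level_def by (intro Greatest_le_nat[of _ _ "Suc N"]) (use bound in auto)
    then show False by simp
  qed
qed

text \<open>For fixed \<open>r\<close> this is affine in \<open>N\<close> with slope
  \<open>r\<close>; for fixed \<open>N\<close> it is concave in \<open>r\<close>.\<close>

definition line :: "nat \<Rightarrow> nat \<Rightarrow> int" where
  "line r N = (\<Sum>i=1..r. int N + 1 - int (triangle i))"

lemma line_0 [simp]: "line 0 N = 0"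
  and line_Suc: "line (Suc r) N = line r N + (int N + 1 - int (triangle (Suc r)))"
  by (simp_all add: line_def)

lemma line_add: "line r (N + d) = line r N + int r * int d"
  by (simp add: line_def sum.distrib sum_subtractf algebra_simps)

text \<open>The increment from \<open>line r N\<close> to \<open>line (Suc r) N\<close> is
  nonnegative for \<open>r < R\<close> and nonpositive for \<open>r \<ge> R\<close>.\<close>

lemma line_le_line:
  assumes "triangle R \<le> Suc N" "Suc N \<le> triangle (Suc R)"
  shows "line r N \<le> line R N"
proof (cases "r \<le> R")
  case True
  then show ?thesis
  proof (induction rule: inc_induct)
    case (step i)
    have "triangle (Suc i) \<le> Suc N"
      using triangle_mono[of "Suc i" R] step assms by linarith
    then show ?case using step.IH by (simp add: line_Suc)
  qed simp
next
  case False
  then have "R \<le> r" by simp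
  then show ?thesis
  proof (induction rule: dec_induct)
    case (step i)
    have "Suc N \<le> triangle (Suc i)"
      using triangle_mono[of "Suc R" "Suc i"] step assms by linarith
    then show ?case using step.IH by (simp add: line_Suc)
  qed simp
qed

text \<open>By concavity, a maximiser only has to match its two neighbours. Both bounds are
  non-strict, since \<open>r\<close> and \<open>Suc r\<close> tie when
  \<open>Suc N = triangle (Suc r)\<close>.\<close>

lemma line_eq_line_iff:
  assumes R: "triangle R \<le> Suc N" "Suc N \<le> triangle (Suc R)"
  shows "line r N = line R N \<longleftrightarrow> triangle r \<le> Suc N \<and> Suc N \<le> triangle (Suc r)"
proof
  assume eq: "line r N = line R N"
  have "line (Suc r) N \<le> line r N"
    unfolding eq by (rule line_le_line[OF R])
  then have "Suc N \<le> triangle (Suc r)" by (simp add: line_Suc)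
  moreover have "triangle r \<le> Suc N"
  proof (cases r)
    case (Suc q)
    have "line q N \<le> line r N"
      unfolding eq by (rule line_le_line[OF R])
    then show ?thesis by (simp add: line_Suc Suc)
  qed simp
  ultimately show "triangle r \<le> Suc N \<and> Suc N \<le> triangle (Suc r)" by simp
next
  assume "triangle r \<le> Suc N \<and> Suc N \<le> triangle (Suc r)"
  then show "line r N = line R N"
    using line_le_line[OF R, of r] line_le_line[of r N R] by simp
qed

text \<open>The value that turns out to be the maximal inversion number \<open>M N\<close>.\<close>

definition peak :: "nat \<Rightarrow> int" where
  "peak N = int (triangle N) - line (level N) N"

lemma peak_le: "peak N \<le> int (triangle N) - line r N"
  using line_le_line[OF level_bounds(1) less_imp_le[OF level_bounds(2)], of r N] by (simp add: peak_def)

lemma peak_eq_iff: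
  "peak N = int (triangle N) - line r N \<longleftrightarrow> triangle r \<le> Suc N \<and> Suc N \<le> triangle (Suc r)"
  using line_eq_line_iff[OF level_bounds(1) less_imp_le[OF level_bounds(2)], of r N]
  unfolding peak_def by auto

lemma peak_0 [simp]: "peak 0 = 0"
  using peak_eq_iff[of 0 0] by simp

text \<open>The term \<open>Suc r\<close> for \<open>N\<close> is compared with the term
  \<open>r\<close> for \<open>N - 1 - k\<close>. By \<open>line_add\<close> both reduce to
  \<open>line r (N - 1 - k)\<close>, and what is left over is quadratic in \<open>k - r\<close>. The
  factor 2 avoids halves.\<close>

lemma peak_gap:
  assumes R: "triangle (Suc r) \<le> Suc N" "Suc N \<le> triangle (Suc (Suc r))" and k: "k < N"
  shows "2 * (peak N - int (k * (N - k)) - (int (triangle (N - 1 - k)) - line r (N - 1 - k))) =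
    (int k - int r) * (int k - int r - 1)"
proof -
  define M where "M = N - 1 - k"
  have N: "N = M + Suc k" using k M_def by simp
  have "peak N = int (triangle N) - line (Suc r) N"
    using R by (simp add: peak_eq_iff)
  moreover have "line (Suc r) N = line r M + int r * int (Suc k) + (int N + 1) - int (triangle (Suc r))"
    using line_add[of r M "Suc k"] unfolding line_Suc N[symmetric] by (simp add: algebra_simps)
  ultimately have "2 * (peak N - int (k * (N - k)) - (int (triangle M) - line r M)) =
     2 * int (triangle N) - 2 * int (k * (N - k)) - 2 * int (triangle M)
     - 2 * int r * int (Suc k) - 2 * int N - 2 + 2 * int (triangle (Suc r))"
    by (simp only: algebra_simps)
  also have "\<dots> = (int k - int r) * (int k - int r - 1)"
    unfolding double_triangle N by (simp add: algebra_simps)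
  finally show ?thesis unfolding M_def .
qed

lemma int_mult_pred_nonneg: "0 \<le> (x::int) * (x - 1)"
  by (cases "x \<le> 0") (auto simp: mult_nonpos_nonpos)

lemma peak_step_le:
  assumes "k < N"
  shows "int (k * (N - k)) + peak (N - 1 - k) \<le> peak N"
proof -
  \<comment> \<open>\<open>level N\<close> is not 0, because \<open>triangle 1 = 1\<close> does not
    exceed \<open>Suc N\<close>.\<close>
  obtain r where r: "level N = Suc r"
    using level_bounds(2)[of N] by (cases "level N") auto
  have le: "2 * (a - b - c) = q \<Longrightarrow> d \<le> c \<Longrightarrow> 0 \<le> q \<Longrightarrow> b + d \<le> a" for a b c d q :: int
    by presburger
  have "triangle (Suc r) \<le> Suc N" "Suc N \<le> triangle (Suc (Suc r))"
    using level_bounds[of N] by (simp_all only: r less_imp_le)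
  from le[OF peak_gap[OF this assms] peak_le int_mult_pred_nonneg] show ?thesis .
qed

text \<open>Two slacks must vanish: the product of consecutive integers, which gives
  \<open>k \<in> {r, Suc r}\<close>, and the gap between \<open>peak (N - 1 - k)\<close> and its
  term \<open>r\<close>, which gives the bounds on \<open>N - k\<close>.\<close>

lemma peak_step_eq_iff:
  assumes R: "triangle (Suc r) \<le> Suc N" "Suc N \<le> triangle (Suc (Suc r))" and k: "k < N"
  shows "int (k * (N - k)) + peak (N - 1 - k) = peak N \<longleftrightarrow>
    k \<in> {r, Suc r} \<and> triangle r \<le> N - k \<and> N - k \<le> triangle (Suc r)"
proof -
  have "Suc (N - 1 - k) = N - k" using k by simp
  then have tight: "peak (N - 1 - k) = int (triangle (N - 1 - k)) - line r (N - 1 - k) \<longleftrightarrow>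
      triangle r \<le> N - k \<and> N - k \<le> triangle (Suc r)"
    unfolding peak_eq_iff by (simp only:)
  have eq_iff: "2 * (a - b - c) = q \<Longrightarrow> d \<le> c \<Longrightarrow> 0 \<le> q \<Longrightarrow> b + d = a \<longleftrightarrow> q = 0 \<and> d = c" for a b c d q :: int
    by presburger
  have "int (k * (N - k)) + peak (N - 1 - k) = peak N \<longleftrightarrow>
      (int k - int r) * (int k - int r - 1) = 0 \<and>
      peak (N - 1 - k) = int (triangle (N - 1 - k)) - line r (N - 1 - k)"
    by (rule eq_iff[OF peak_gap[OF R k] peak_le int_mult_pred_nonneg])
  moreover have "(int k - int r) * (int k - int r - 1) = 0 \<longleftrightarrow> k \<in> {r, Suc r}"
    by auto
  ultimately show ?thesis using tight by simp
qed

section \<open>Upper bound and structure of the extremal words\<close>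

lemma avoiding_cases:
  assumes "xs \<noteq> []" "distinct xs" "avoiding xs"
  obtains as m bs where "xs = as @ m # bs" "\<And>x. x \<in> set as \<union> set bs \<Longrightarrow> m < x"
    "sorted as" "avoiding bs"
proof -
  have "Min (set xs) \<in> set xs" using assms by simp
  then obtain as bs where xs: "xs = as @ Min (set xs) # bs" by (metis split_list)
  have less: "Min (set xs) < x" if "x \<in> set as \<union> set bs" for x
  proof -
    have "x \<in> set xs" using that by (subst xs) auto
    then have "Min (set xs) \<le> x" by simp
    moreover have "distinct (as @ Min (set xs) # bs)" using assms(2) xs by argo
    then have "Min (set xs) \<noteq> x" using that by auto
    ultimately show ?thesis by simp
  qed
  then have "sorted as \<and> avoiding bs"
    using avoiding_append_Cons_least[of as bs "Min (set xs)"] assms(3) xs by simp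
  then show ?thesis using that xs less by blast
qed

text \<open>Induction over the length, as \<open>bs\<close> may be much shorter than the word. The
  \<open>length as\<close> inversions with \<open>m\<close> and the at most
  \<open>length as * length bs\<close> cross inversions together give the product in
  \<open>peak_step_le\<close>.\<close>

lemma inversions_le_peak:
  "distinct xs \<Longrightarrow> avoiding xs \<Longrightarrow> int (inversions xs) \<le> peak (length xs)"
proof (induction xs rule: length_induct)
  case (1 xs)
  show ?case
  proof (cases "xs = []")
    case False
    then obtain as m bs where xs: "xs = as @ m # bs" and less: "\<And>x. x \<in> set as \<union> set bs \<Longrightarrow> m < x"
      and as: "sorted as" and bs: "avoiding bs"
      using avoiding_cases 1 by blast
    have "int (inversions bs) \<le> peak (length bs)"
      using 1 bs xs by simp
    moreover have "inversions xs \<le> length as * (length xs - length as) + inversions bs"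
      using inversions_append_Cons_least[OF less as] cross_inversions_le[of bs as] xs by simp
    moreover have "int (length as * (length xs - length as)) + peak (length bs) \<le> peak (length xs)"
      using peak_step_le[of "length as" "length xs"] xs by simp
    ultimately show ?thesis by linarith
  qed simp
qed

text \<open>Defined through \<open>peak\<close> rather than a maximum; that the bound is attained
  follows later from a positive count. Any set of letters is allowed, so that the recursion needs no
  relabelling.\<close>

definition extremal :: "'a::linorder set \<Rightarrow> 'a list set" where
  "extremal V = {xs \<in> permutations_of_set V. avoiding xs \<and> int (inversions xs) = peak (card V)}"

lemma extremal_empty [simp]: "extremal {} = {[]}"
  by (auto simp: extremal_def)

lemma finite_extremal [simp]: "finite (extremal V)"
  by (simp add: extremal_def)

text \<open>The upper bound chains three estimates, for the cross inversions, for \<open>bs\<close>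
  and for the choice of \<open>k\<close>; the ends agree iff each of them is tight.\<close>

lemma extremal_append_Cons_iff:
  assumes "distinct (as @ m # bs)" and less: "\<And>x. x \<in> set as \<union> set bs \<Longrightarrow> m < x"
  defines "k \<equiv> length as" and "N \<equiv> length (as @ m # bs)"
  shows "as @ m # bs \<in> extremal (set (as @ m # bs)) \<longleftrightarrow>
    sorted as \<and> (\<forall>a\<in>set as. \<forall>b\<in>set bs. b < a) \<and> bs \<in> extremal (set bs) \<and>
    int (k * (N - k)) + peak (N - 1 - k) = peak N"
    (is "?L \<longleftrightarrow> ?R")
proof (cases "sorted as \<and> avoiding bs")
  case False
  then show ?thesis
    using avoiding_append_Cons_least[OF less] by (auto simp: extremal_def)
next
  case True
  let ?c = "\<Sum>a\<leftarrow>as. length (filter (\<lambda>b. b < a) bs)"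
  have av: "avoiding (as @ m # bs)"
    using avoiding_append_Cons_least[OF less] True by blast
  have cardN: "card (set (as @ m # bs)) = N" and cardb: "card (set bs) = length bs"
    using assms(1) by (simp_all only: N_def distinct_card) (simp add: distinct_card)
  have lenb: "N - 1 - k = length bs" by (simp add: N_def k_def)
  have inv: "int (inversions (as @ m # bs)) = int k + int ?c + int (inversions bs)"
    using inversions_append_Cons_least[OF less] True by (simp add: k_def)
  have kN: "int (k * (N - k)) = int k + int (length as * length bs)"
    by (simp add: N_def k_def)
  have "?L \<longleftrightarrow> int (inversions (as @ m # bs)) = peak N"
    using av assms(1) unfolding extremal_def cardN by (auto simp: permutations_of_set_def)
  also have "\<dots> \<longleftrightarrow> ?c = length as * length bs \<and> int (inversions bs) = peak (length bs) \<and>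
      int (k * (N - k)) + peak (N - 1 - k) = peak N"
  proof -
    have squeeze: "i = int k + int c + b \<Longrightarrow> x = int k + int d \<Longrightarrow> c \<le> d \<Longrightarrow> b \<le> q \<Longrightarrow>
        x + q \<le> z \<Longrightarrow> i = z \<longleftrightarrow> c = d \<and> b = q \<and> x + q = z" for i b x q z :: int and c d
      by (intro iffI conjI; (elim conjE)?; linarith)
    have "int (inversions bs) \<le> peak (length bs)"
      using inversions_le_peak[of bs] True assms(1) by simp
    moreover have "int (k * (N - k)) + peak (length bs) \<le> peak N"
      using peak_step_le[of k N] unfolding lenb by (simp add: N_def k_def)
    ultimately show ?thesis
      unfolding lenb by (rule squeeze[OF inv kN cross_inversions_le])
  qed
  also have "\<dots> \<longleftrightarrow> ?R"
    unfolding cross_inversions_eq_iff extremal_def cardb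
    using True assms(1) by (auto simp: permutations_of_set_def)
  finally show ?thesis .
qed

text \<open>The letters before \<open>m\<close> are the \<open>k\<close> largest in increasing
  order, hence \<open>drop (N - 1 - k) L\<close>; an extremal word on the remaining letters follows
  \<open>m\<close>.\<close>

lemma extremal_rec:
  fixes m :: "'a::linorder"
  assumes L: "sorted (m # L)" "distinct (m # L)"
  defines "N \<equiv> length (m # L)"
  shows "extremal (set (m # L)) =
    (\<Union>k\<in>{k. k < N \<and> int (k * (N - k)) + peak (N - 1 - k) = peak N}.
      (\<lambda>bs. drop (N - 1 - k) L @ m # bs) ` extremal (set (take (N - 1 - k) L)))"
    (is "_ = (\<Union>k\<in>?K. ?F k)")
proof (rule subset_antisym; rule subsetI)
  fix xs assume xs: "xs \<in> extremal (set (m # L))"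
  then have set: "set xs = set (m # L)" and dist: "distinct xs" and "avoiding xs"
    unfolding extremal_def permutations_of_set_def by blast+
  moreover have "xs \<noteq> []" using set by auto
  ultimately obtain as m' bs where eq: "xs = as @ m' # bs"
    and less: "\<And>x. x \<in> set as \<union> set bs \<Longrightarrow> m' < x" and as: "sorted as"
    using avoiding_cases by metis
  have len: "length xs = N"
    using set dist L unfolding N_def by (metis distinct_card)
  have ext: "(\<forall>a\<in>set as. \<forall>b\<in>set bs. b < a) \<and> bs \<in> extremal (set bs) \<and>
      int (length as * (N - length as)) + peak (N - 1 - length as) = peak N"
  proof -
    have "as @ m' # bs \<in> extremal (set (as @ m' # bs))"
      using xs unfolding set[symmetric] eq .
    from iffD1[OF extremal_append_Cons_iff[OF dist[unfolded eq] less] this]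
    show ?thesis unfolding len[unfolded eq] by blast
  qed
  \<comment> \<open>All letters of \<open>bs\<close> lie below those of \<open>as\<close>, so both
    sides are the sorted list of all letters. This identifies \<open>m'\<close>, \<open>as\<close>
    and the set of letters of \<open>bs\<close>.\<close>
  have "m' # sorted_list_of_set (set bs) @ as = m # L"
  proof (rule sorted_distinct_set_unique)
    show "sorted (m' # sorted_list_of_set (set bs) @ as)"
      using less as ext by (auto simp: sorted_append less_imp_le)
    show "distinct (m' # sorted_list_of_set (set bs) @ as)"
      using dist eq by auto
    show "set (m' # sorted_list_of_set (set bs) @ as) = set (m # L)"
      using set eq by auto
  qed (use L in auto)
  then have m': "m' = m" and L_eq: "L = sorted_list_of_set (set bs) @ as" by auto
  have lenb: "length (sorted_list_of_set (set bs)) = N - 1 - length as"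
    using len dist eq by (auto simp: distinct_card)
  then have "drop (N - 1 - length as) L = as" "set (take (N - 1 - length as) L) = set bs"
    unfolding L_eq by simp_all
  then have "xs \<in> ?F (length as)" using eq m' ext by auto
  moreover have "length as < N" using len eq by auto
  ultimately show "xs \<in> (\<Union>k\<in>?K. ?F k)" using ext by blast
next
  fix xs assume "xs \<in> (\<Union>k\<in>?K. ?F k)"
  then obtain k bs where k: "k < N" "int (k * (N - k)) + peak (N - 1 - k) = peak N"
    and xs: "xs = drop (N - 1 - k) L @ m # bs" and bs: "bs \<in> extremal (set (take (N - 1 - k) L))"
    by blast
  define as where "as = drop (N - 1 - k) L"
  define cs where "cs = take (N - 1 - k) L"
  have L_eq: "L = cs @ as" by (simp add: as_def cs_def)
  have bs_cs: "set bs = set cs" "distinct bs"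
    using bs by (auto simp: extremal_def permutations_of_set_def cs_def)
  have lena: "length as = k" using k by (simp add: as_def N_def)
  have "length bs = length cs"
    using bs_cs L L_eq by (metis distinct_append distinct_card distinct.simps(2))
  then have lenN: "length (as @ m # bs) = N" by (simp add: N_def L_eq)
  have dist: "distinct (as @ m # bs)" using L bs_cs L_eq by auto
  have less: "m < x" if "x \<in> set as \<union> set bs" for x
    using that L bs_cs L_eq by (auto simp: less_le)
  have set: "set (m # L) = set (as @ m # bs)" using bs_cs L_eq by auto
  have "\<forall>a\<in>set as. \<forall>b\<in>set bs. b < a"
    using L bs_cs L_eq by (auto simp: sorted_append less_le)
  moreover have "sorted as" using L L_eq by (simp add: sorted_append)
  ultimately have "as @ m # bs \<in> extremal (set (as @ m # bs))"
    using extremal_append_Cons_iff[OF dist less] k bs unfolding lena lenN bs_cs(1) cs_def by blast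
  then show "xs \<in> extremal (set (m # L))" unfolding set xs as_def .
qed

section \<open>Counting the extremal words\<close>

lemma card_extremal_rec:
  fixes m :: "'a::linorder"
  assumes L: "sorted (m # L)" "distinct (m # L)"
  defines "N \<equiv> length (m # L)"
  shows "card (extremal (set (m # L))) =
    (\<Sum>k | k < N \<and> int (k * (N - k)) + peak (N - 1 - k) = peak N.
      card (extremal (set (take (N - 1 - k) L))))"
proof -
  let ?K = "{k. k < N \<and> int (k * (N - k)) + peak (N - 1 - k) = peak N}"
  let ?F = "\<lambda>k. (\<lambda>bs. drop (N - 1 - k) L @ m # bs) ` extremal (set (take (N - 1 - k) L))"
  \<comment> \<open>The number of letters before \<open>m\<close> recovers \<open>k\<close>, so
    different \<open>k\<close> give disjoint sets of words.\<close>
  have prefix: "length (takeWhile (\<lambda>x. x \<noteq> m) xs) = k" if "xs \<in> ?F k" "k \<in> ?K" for xs k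
  proof -
    obtain bs where xs: "xs = drop (N - 1 - k) L @ m # bs" using \<open>xs \<in> ?F k\<close> by blast
    have "m \<notin> set (drop (N - 1 - k) L)" using L by (auto dest: in_set_dropD)
    then have "takeWhile (\<lambda>x. x \<noteq> m) xs = drop (N - 1 - k) L"
      unfolding xs by (subst takeWhile_append2) auto
    then show ?thesis using that by (auto simp: N_def)
  qed
  have "card (extremal (set (m # L))) = card (\<Union>k\<in>?K. ?F k)"
    using extremal_rec[OF L] unfolding N_def by simp
  also have "\<dots> = (\<Sum>k\<in>?K. card (?F k))"
  proof (rule card_UN_disjoint)
    show "\<forall>i\<in>?K. \<forall>j\<in>?K. i \<noteq> j \<longrightarrow> ?F i \<inter> ?F j = {}"
    proof (intro ballI impI equals0I)
      fix i j xs assume i: "i \<in> ?K" and j: "j \<in> ?K" and "i \<noteq> j" and xs: "xs \<in> ?F i \<inter> ?F j"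
      show False
        using \<open>i \<noteq> j\<close> trans[OF prefix[OF IntD1[OF xs] i, symmetric] prefix[OF IntD2[OF xs] j]] by (rule notE)
    qed
  qed auto
  also have "\<dots> = (\<Sum>k\<in>?K. card (extremal (set (take (N - 1 - k) L))))"
    by (intro sum.cong refl card_image) (simp add: inj_on_def)
  finally show ?thesis .
qed

text \<open>The claimed count with natural arguments; the case \<open>l = 0\<close> accounts for the
  lower entry -1.\<close>

definition extremal_count :: "nat \<Rightarrow> nat \<Rightarrow> nat" where
  "extremal_count r l = (r choose l) + (if l = 0 then 0 else Suc r choose (l - 1))"

text \<open>Needed to see that \<open>peak\<close> is attained. At \<open>l = Suc r\<close> the
  second binomial, \<open>Suc r choose r\<close>, is the positive one.\<close>

lemma extremal_count_pos: "l \<le> Suc r \<Longrightarrow> 0 < extremal_count r l"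
  by (cases "l \<le> r") (auto simp: extremal_count_def)

text \<open>Pascal's rule in both binomials; \<open>l = 1\<close> is separate, as the second one
  then has lower entry 0.\<close>

lemma extremal_count_Suc:
  "extremal_count (Suc r) l = extremal_count r l + (if l = 0 then 0 else extremal_count r (l - 1))"
proof (cases l)
  case (Suc k)
  then show ?thesis by (cases k) (auto simp: extremal_count_def)
qed (simp add: extremal_count_def)

text \<open>The range of \<open>l\<close> exceeds that of \<open>\<lambda>\<close> by one: \<open>(r, r + 2)\<close> and \<open>(r + 1, 0)\<close> describe the same size,
  and admitting both spares a case distinction when the recursion crosses a triangular number.\<close>

lemma card_extremal:
  assumes "finite V" "Suc (card V) = triangle (Suc r) + l" "l \<le> Suc (Suc r)"
  shows "card (extremal V) = extremal_count r l"
  using assms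
proof (induction r arbitrary: V l)
  case 0
  show ?case
  proof (cases "V = {}")
    case False
    define N where "N = card V"
    have "0 < N" using False 0(1) by (simp add: N_def card_gt_0_iff)
    then have N: "N = l" "l = 1 \<or> l = 2" using 0 by (auto simp: N_def)
    obtain m L where mL: "sorted_list_of_set V = m # L"
      using False 0 by (metis neq_Nil_conv sorted_list_of_set_eq_Nil_iff)
    then have V: "V = set (m # L)" "sorted (m # L)" "distinct (m # L)" "length (m # L) = N"
      using 0(1) unfolding mL[symmetric] by (auto simp: N_def)
    \<comment> \<open>As \<open>N - k \<le> triangle 1\<close>, only \<open>k = N - 1\<close>
      remains: the least letter comes last and the word is unique.\<close>
    have "k < N \<and> int (k * (N - k)) + peak (N - 1 - k) = peak N \<longleftrightarrow> k = N - 1" for k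
      using peak_step_eq_iff[of 0 N k] N by (auto simp: numeral_2_eq_2)
    then have "card (extremal V) = 1"
      unfolding V(1) card_extremal_rec[OF V(2,3)] V(4) by simp
    then show ?thesis using N by (auto simp: extremal_count_def numeral_2_eq_2)
  qed (use 0 in \<open>simp add: extremal_count_def\<close>)
next
  case (Suc r)
  define N where "N = card V"
  have N: "Suc N = triangle (Suc r) + Suc (Suc r) + l" "l \<le> Suc (Suc (Suc r))"
    using Suc.prems by (simp_all add: N_def)
  have "0 < N" using N by simp
  then obtain m L where mL: "sorted_list_of_set V = m # L"
    using Suc.prems(1) by (metis N_def card.empty less_irrefl neq_Nil_conv sorted_list_of_set_eq_Nil_iff)
  then have V: "V = set (m # L)" "sorted (m # L)" "distinct (m # L)" "length (m # L) = N"
    using Suc.prems(1) unfolding mL[symmetric] by (auto simp: N_def)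
  let ?c = "\<lambda>k. card (extremal (set (take (N - 1 - k) L)))"
  have low: "card (set (take (N - 1 - k) L)) = N - 1 - k" for k
    using V by (simp add: distinct_card)
  \<comment> \<open>Removing \<open>k + 1\<close> letters with \<open>k = Suc r\<close> turns
    \<open>triangle (Suc (Suc r)) + l\<close> into \<open>triangle (Suc r) + l\<close>; removing one
    more lowers \<open>l\<close> by 1.\<close>
  have c1: "?c (Suc r) = extremal_count r l" if "l \<le> Suc (Suc r)"
    by (rule Suc.IH, simp, unfold low) (use that N in simp_all)
  have c2: "?c (Suc (Suc r)) = extremal_count r (l - 1)" if "l \<noteq> 0"
    by (rule Suc.IH, simp, unfold low) (use that N in simp_all)
  \<comment> \<open>The first choice is lost only at \<open>l = r + 3\<close>, the second only at
    \<open>l = 0\<close>.\<close>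
  have K: "k < N \<and> int (k * (N - k)) + peak (N - 1 - k) = peak N \<longleftrightarrow>
      k = Suc r \<and> l \<le> Suc (Suc r) \<or> k = Suc (Suc r) \<and> l \<noteq> 0" for k
  proof -
    have "k < N \<and> k \<in> {Suc r, Suc (Suc r)} \<and> triangle (Suc r) \<le> N - k \<and> N - k \<le> triangle (Suc (Suc r))
        \<longleftrightarrow> k = Suc r \<and> l \<le> Suc (Suc r) \<or> k = Suc (Suc r) \<and> l \<noteq> 0"
      using N by (auto simp: not_le)
    moreover have "triangle (Suc (Suc r)) \<le> Suc N" "Suc N \<le> triangle (Suc (Suc (Suc r)))"
      using N by simp_all
    ultimately show ?thesis
      using peak_step_eq_iff[of "Suc r" N k] by blast
  qed
  have "card (extremal V) =
      (\<Sum>k | k = Suc r \<and> l \<le> Suc (Suc r) \<or> k = Suc (Suc r) \<and> l \<noteq> 0. ?c k)"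
    unfolding V(1) card_extremal_rec[OF V(2,3)] V(4) K ..
  also have "{k. k = Suc r \<and> l \<le> Suc (Suc r) \<or> k = Suc (Suc r) \<and> l \<noteq> 0} =
      (if l \<le> Suc (Suc r) then {Suc r} else {}) \<union> (if l \<noteq> 0 then {Suc (Suc r)} else {})"
    by auto
  also have "(\<Sum>k\<in>\<dots>. ?c k) = extremal_count (Suc r) l"
  proof (cases "l \<le> Suc (Suc r)")
    case True
    then show ?thesis using c1 c2 by (simp add: extremal_count_Suc)
  next
    case False
    \<comment> \<open>Here \<open>l = r + 3\<close>, so both binomials vanish and the recurrence
      agrees with the single remaining choice.\<close>
    then have "extremal_count r l = 0" by (simp add: extremal_count_def)
    then show ?thesis using False c2 by (simp add: extremal_count_Suc)
  qed
  finally show ?case .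
qed

section \<open>Transfer to permutations\<close>

lemma inv_num_eq: "inv_num N p = inversions (map p [1..<Suc N])"
  unfolding inv_num_def inversions_map_upt by (rule arg_cong[where f = card]) auto

lemma avoids_u32_1_eq: "avoids_u32_1 N p \<longleftrightarrow> avoiding (map p [1..<Suc N])"
  unfolding avoids_u32_1_def avoiding_map_upt by (simp add: less_Suc_eq_le)

lemma bij_betw_filter:
  assumes "bij_betw f A B"
  shows "bij_betw f {x \<in> A. P (f x)} {y \<in> B. P y}"
  using assms by (auto simp: bij_betw_def inj_on_def)

text \<open>\<open>inversions_le_peak\<close> bounds the maximum, and the positive count shows that
  the bound is attained; maximal permutations then correspond to the words in
  \<open>extremal {1..N}\<close>.\<close>

lemma extremal_permutations:
  assumes "Suc N = triangle (Suc r) + l" "l \<le> Suc r"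
  shows "int (maxinv_u32_1 N) = peak N" "card (Z_u32_1 N) = extremal_count r l"
proof -
  let ?f = "\<lambda>p::nat \<Rightarrow> nat. map p [1..<Suc N]"
  have bij: "bij_betw ?f (S_u32_1 N) {xs \<in> permutations_of_set {1..N}. avoiding xs}"
    using bij_betw_filter[OF bij_betw_map_permutes, where P = avoiding]
    unfolding S_u32_1_def avoids_u32_1_eq by simp
  have card: "card (extremal {1..N}) = extremal_count r l"
    by (rule card_extremal) (use assms in auto)
  then have "extremal {1..N} \<noteq> {}"
    using extremal_count_pos[OF assms(2)] by auto
  then obtain xs where xs: "xs \<in> permutations_of_set {1..N}" "avoiding xs" "int (inversions xs) = peak N"
    by (auto simp: extremal_def)
  then obtain p where p: "p \<in> S_u32_1 N" "?f p = xs"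
    using bij unfolding bij_betw_def by (metis (mono_tags, lifting) imageE mem_Collect_eq)
  have "finite (S_u32_1 N)"
    using bij_betw_finite[OF bij] by simp
  moreover have "inv_num N q \<le> inv_num N p" if "q \<in> S_u32_1 N" for q
  proof -
    have "?f q \<in> {xs \<in> permutations_of_set {1..N}. avoiding xs}"
      using bij that by (auto simp: bij_betw_def simp del: upt_Suc)
    then have "int (inversions (?f q)) \<le> peak (length (?f q))"
      by (intro inversions_le_peak) (auto simp: permutations_of_set_def)
    then have "int (inv_num N q) \<le> peak N"
      unfolding inv_num_eq by (simp del: upt_Suc)
    then show ?thesis using xs p by (simp add: inv_num_eq)
  qed
  ultimately have "maxinv_u32_1 N = inv_num N p"
    unfolding maxinv_u32_1_def using p by (intro Max_eqI) auto
  then show max: "int (maxinv_u32_1 N) = peak N"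
    using xs p by (simp add: inv_num_eq)
  have "inversions xs = maxinv_u32_1 N \<longleftrightarrow> int (inversions xs) = peak N" for xs :: "nat list"
    unfolding max[symmetric] by simp
  then have "bij_betw ?f (Z_u32_1 N) (extremal {1..N})"
    using bij_betw_filter[OF bij, where P = "\<lambda>xs. inversions xs = maxinv_u32_1 N"]
    unfolding Z_u32_1_def extremal_def inv_num_eq by (simp add: conj_assoc)
  then show "card (Z_u32_1 N) = extremal_count r l"
    using card bij_betw_same_card by metis
qed

section \<open>Closed forms for the parameters and the maximum\<close>

lemma triangle_rho:
  assumes "n \<ge> 1"
  shows "triangle (Suc (nat (rho n))) \<le> n + 2" "n + 2 < triangle (Suc (Suc (nat (rho n))))"
proof -
  define r where "r = nat (rho n)"
  have r: "rho n = int r" using rho_bounds[OF assms] by (simp add: r_def)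
  then have "2 * real r + 3 \<le> sqrt (8 * real n + 17)" "sqrt (8 * real n + 17) < 2 * real r + 5"
    using floor_eq_iff[of "(- 3 + sqrt (8 * real n + 17)) / 2" "int r"] unfolding rho_def by auto
  then have "(2 * real r + 3)\<^sup>2 \<le> 8 * real n + 17" "8 * real n + 17 < (2 * real r + 5)\<^sup>2"
    using power_mono[of "2 * real r + 3" "sqrt (8 * real n + 17)" 2]
      power_strict_mono[of "sqrt (8 * real n + 17)" "2 * real r + 5" 2] by simp_all
  then have "real ((2 * r + 3)\<^sup>2) \<le> real (8 * n + 17)" "real (8 * n + 17) < real ((2 * r + 5)\<^sup>2)"
    by simp_all
  then have "(2 * r + 3)\<^sup>2 \<le> 8 * n + 17" "8 * n + 17 < (2 * r + 5)\<^sup>2"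
    unfolding of_nat_le_iff of_nat_less_iff .
  moreover have "2 * triangle r = r * r + r"
    by (induction r) auto
  \<comment> \<open>The square of \<open>2 * r + 3\<close> is
    \<open>8 * triangle (Suc r) + 1\<close>, and
    \<open>8 * n + 17 = 8 * (n + 2) + 1\<close>.\<close>
  ultimately have "triangle (Suc r) \<le> n + 2 \<and> n + 2 < triangle (Suc (Suc r))"
    by (simp add: power2_eq_square algebra_simps)
  then show "triangle (Suc (nat (rho n))) \<le> n + 2" "n + 2 < triangle (Suc (Suc (nat (rho n))))"
    by (simp_all add: r_def)
qed

lemma tri_int: "tri (int k) = triangle k"
  unfolding tri_eq_sum by (induction k) auto

lemma sum_tri_int: "(\<Sum>i=1..int k. tri i) = (\<Sum>i=1..k. triangle i)"
  by (rule sum.reindex_bij_witness[of _ int nat]) (auto simp flip: tri_int)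

lemma ibinom_int: "ibinom (int a) (int b) = a choose b"
  by (simp add: ibinom_def)

text \<open>The hockey-stick identity.\<close>

lemma sum_triangle: "(\<Sum>i=1..k. triangle i) = (k + 2) choose 3"
proof (induction k)
  case (Suc k)
  have "triangle (Suc k) = (k + 2) choose 2"
    by (induction k) (auto simp: numeral_2_eq_2)
  with Suc show ?case by (simp add: numeral_3_eq_3 numeral_2_eq_2)
qed simp

lemma peak_closed_form:
  assumes "triangle (Suc r) \<le> n + 2" "n + 2 \<le> triangle (Suc (Suc r))" "r \<le> n"
  shows "peak (n + 1) = int (triangle (n - r) + (\<Sum>i=1..r. triangle i))"
proof -
  obtain d where n: "n = r + d" using assms(3) le_Suc_ex by blast
  have "line (Suc r) (n + 1) = (int r + 1) * (int n + 2) - int (triangle (Suc r)) - int (\<Sum>i=1..r. triangle i)"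
    by (simp add: line_def sum_subtractf algebra_simps)
  moreover have "peak (n + 1) = int (triangle (n + 1)) - line (Suc r) (n + 1)"
    using assms unfolding peak_eq_iff by simp
  \<comment> \<open>The \<open>r + 1\<close> largest summands of \<open>triangle (n + 1)\<close> are
    \<open>n + 2 - s\<close> for \<open>s = 1, ..., r + 1\<close>; the others sum to
    \<open>triangle d\<close>.\<close>
  moreover have "int (triangle (n + 1)) + int (triangle (Suc r)) = int (triangle d) + (int r + 1) * (int n + 2)"
    using double_triangle[of "n + 1"] double_triangle[of "Suc r"] double_triangle[of d]
    unfolding n by (simp add: algebra_simps)
  ultimately show ?thesis by (simp add: n)
qed

theorem theorem1p3:
  fixes n :: nat
  assumes "n \<ge> 1"
  shows "card (Z_u32_1 (n + 1)) = ibinom (rho n) (lambda n) + ibinom (rho n + 1) (lambda n - 1)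
    \<and> maxinv_u32_1 (n + 1) = tri (int n - rho n) + (\<Sum>i=1..rho n. tri i)
    \<and> tri (int n - rho n) + (\<Sum>i=1..rho n. tri i) =
           ibinom (int n - rho n + 1) 2 + ibinom (rho n + 2) 3"
proof -
  define r where "r = nat (rho n)"
  have rho: "rho n = int r" and "r \<le> n" using rho_bounds[OF assms] by (simp_all add: r_def)
  have bounds: "triangle (Suc r) \<le> n + 2" "n + 2 < triangle (Suc (Suc r))"
    using triangle_rho[OF assms] by (simp_all add: r_def)
  define l where "l = n + 2 - triangle (Suc r)"
  have l: "Suc (n + 1) = triangle (Suc r) + l" "l \<le> Suc r"
    using bounds by (simp_all add: l_def)
  have lambda: "lambda n = int l"
    using l(1) tri_int[of "Suc r"] by (simp add: lambda_def rho add.commute)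
  have tri_diff: "tri (int n - rho n) = triangle (n - r)"
    using \<open>r \<le> n\<close> by (simp add: rho flip: tri_int of_nat_diff)
  have "ibinom (rho n) (lambda n) + ibinom (rho n + 1) (lambda n - 1) = extremal_count r l"
  proof (cases l)
    \<comment> \<open>The lower entry \<open>lambda n - 1\<close> is -1 here, so the second
      \<open>ibinom\<close> is 0 by convention.\<close>
    case 0
    then show ?thesis by (simp add: rho lambda ibinom_def extremal_count_def)
  next
    case (Suc k)
    have "ibinom (rho n + 1) (lambda n - 1) = ibinom (int (Suc r)) (int k)"
      by (simp add: rho lambda Suc add.commute)
    then show ?thesis
      using Suc by (simp only: ibinom_int rho lambda extremal_count_def) simp
  qed
  moreover have "int (maxinv_u32_1 (n + 1)) = int (triangle (n - r) + (\<Sum>i=1..r. triangle i))"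
    unfolding extremal_permutations(1)[OF l]
    by (rule peak_closed_form) (use bounds \<open>r \<le> n\<close> in auto)
  then have "maxinv_u32_1 (n + 1) = triangle (n - r) + (\<Sum>i=1..r. triangle i)"
    unfolding of_nat_eq_iff .
  moreover have "(\<Sum>i=1..rho n. tri i) = (\<Sum>i=1..r. triangle i)"
    unfolding rho by (rule sum_tri_int)
  moreover have "(\<Sum>i=1..r. triangle i) = ibinom (rho n + 2) 3"
    using ibinom_int[of "r + 2" 3] unfolding sum_triangle rho by (simp add: add.commute)
  moreover have "tri (int n - rho n) = ibinom (int n - rho n + 1) 2"
    by (simp add: tri_def)
  ultimately show ?thesis
    using extremal_permutations(2)[OF l] tri_diff by simp
qed

end
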